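(* Let $\delta>0$, $k$ a positive integer, and let $\{(S_i,G_i)\}_{i\ge1}$ be a family of systems of configurations of degree $k$. Write $$p_{(S_i,G_i)}=\min\left\{\max_{U\subseteq[1,k],\,|U|\ge2}\left(\frac{|G_i|}{|\pi_U(S_i^{(k)})|}\right)^{\frac{1}{|U|-1}},\ 1\right\}.$$ There is a constant $c=c(\delta,k,\{(S_i,G_i)\}_{i\ge1})>0$ such that the following holds. If $p=p(i)$ satisfies $$\max\left\{|G_i|^{-1},|S_i^{(k)}|^{-1/k}\right\}=o(p)\quad\text{and}\quad p\le c\,p_{(S_i,G_i)},$$ and the family is concentrated for $p$, then $$\lim_{i\to\infty}\mathbb{P}\big([G_i]_p\text{ is }(\delta,S_i)_k\text{-stable}\big)=0.$$
   Context: A system of configurations of degree $k$ is a pair $(S,G)$ with $G$ a finite set and $S\subseteq G^k$; $S^{(k)}$ is the set of elements of $S$ with pairwise distinct coordinates. For $U=\{u_1<\dots<u_m\}\subseteq[1,k]$, $\pi_U(g_1,\dots,g_k)=(g_{u_1},\dots,g_{u_m})$. $[G]_p$ is the binomial random subset of $G$ containing each element independently with probability $p$. A set $X\subseteq G$ is $(\delta,S)_k$-stable if every $X'\subseteq X$ with $|X'|\ge\delta|X|$ satisfies $X'^k\cap S^{(k)}\ne\emptyset$. A sequence $\{(S_i,G_i)\}$ with $n_i=|G_i|$ is concentrated for $p=p(i)\in[0,1]$ if for all $\varepsilon,\varepsilon'>0$ there is $n_0$ such that for all $i$ with $n_i\ge n_0$ and all $U\subseteq[1,k]$ with $|U|\ge2$,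 $$\mathbb{P}\left(\Big|\,|\pi_U(S_i^{(k)})\cap[G_i]_p^{|U|}|-p^{|U|}|\pi_U(S_i^{(k)})|\,\Big|\ge\varepsilon\,p^{|U|}|\pi_U(S_i^{(k)})|\right)\le\varepsilon'.$$
   Formalization: The formal theorem assumes 0 < δ < 1 instead of δ > 0; for δ ≥ 1 the claim is false (e.g. 3-term progressions in Z_n, n odd, p = n^{-0.6}: the random set is stable with probability tending to 1). *)

theory Defs
  imports "HOL-Probability.Probability" "HOL-Probability.Product_PMF" "HOL-Library.Landau_Symbols"
begin

text \<open>
  Tuples are lists, and coordinate positions are numbered from 0, so that the index set
  \<open>[1,k]\<close> becomes \<open>{..<k}\<close> and the projection onto the coordinates in \<open>U\<close> (taken in
  increasing order) is \<open>\<lambda>xs. nths xs U\<close>.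
\<close>

definition tuples :: "nat \<Rightarrow> 'a set \<Rightarrow> 'a list set" where
  "tuples m X = {xs. length xs = m \<and> set xs \<subseteq> X}"

definition config_system :: "nat \<Rightarrow> 'a list set \<Rightarrow> 'a set \<Rightarrow> bool" where
  "config_system k S G \<longleftrightarrow> finite G \<and> S \<subseteq> tuples k G"

definition distinct_configs :: "'a list set \<Rightarrow> 'a list set" where
  "distinct_configs S = {xs \<in> S. distinct xs}"

definition proj :: "nat set \<Rightarrow> 'a list set \<Rightarrow> 'a list set" where
  "proj U T = (\<lambda>xs. nths xs U) ` T"

definition binomial_subset :: "'a set \<Rightarrow> real \<Rightarrow> 'a set pmf" where
  "binomial_subset G p =
     map_pmf (\<lambda>f. {g \<in> G. f g}) (Pi_pmf G False (\<lambda>_. bernoulli_pmf p))"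

definition config_stable :: "real \<Rightarrow> nat \<Rightarrow> 'a list set \<Rightarrow> 'a set \<Rightarrow> bool" where
  "config_stable \<delta> k S X \<longleftrightarrow>
     (\<forall>X'\<subseteq>X. real (card X') \<ge> \<delta> * real (card X) \<longrightarrow>
        tuples k X' \<inter> distinct_configs S \<noteq> {})"

definition concentrated ::
  "nat \<Rightarrow> (nat \<Rightarrow> 'a list set) \<Rightarrow> (nat \<Rightarrow> 'a set) \<Rightarrow> (nat \<Rightarrow> real) \<Rightarrow> bool" where
  "concentrated k S G p \<longleftrightarrow>
     (\<forall>\<epsilon>>0. \<forall>\<epsilon>'>0. \<exists>n\<^sub>0. \<forall>i. card (G i) \<ge> n\<^sub>0 \<longrightarrow>
        (\<forall>U\<subseteq>{..<k}. card U \<ge> 2 \<longrightarrow>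
           measure_pmf.prob (binomial_subset (G i) (p i))
             {X. \<bar>real (card (proj U (distinct_configs (S i)) \<inter> tuples (card U) X))
                   - p i ^ card U * real (card (proj U (distinct_configs (S i))))\<bar>
                 \<ge> \<epsilon> * (p i ^ card U * real (card (proj U (distinct_configs (S i)))))}
           \<le> \<epsilon>'))"

text \<open>
  If there is no configuration with distinct coordinates, every quotient \<open>|G| / |\<pi>\<^sub>U|\<close> below
  is infinite and the minimum is 1; this has to be said explicitly because \<open>x / 0 = 0\<close> in HOL.
  The inserted 0 only matters for \<open>k \<le> 1\<close>, where the maximum ranges over the empty set;
  otherwise it is absorbed since all the other elements are nonnegative.
\<close>

definition p_threshold :: "nat \<Rightarrow> 'a list set \<Rightarrow> 'a set \<Rightarrow> real" where
  "p_threshold k S G =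
     (if distinct_configs S = {} then 1
      else min (Max (insert 0
        {(real (card G) / real (card (proj U (distinct_configs S)))) powr (1 / (real (card U) - 1))
         | U. U \<subseteq> {..<k} \<and> card U \<ge> 2})) 1)"

end

theory Submission
  imports Defs
begin

text \<open>
  Let \<open>U\<close> attain the maximum defining the threshold. Then \<open>p \<le> c (n / |\<pi>\<^sub>U|)\<^bsup>1/(|U|-1)\<^esup>\<close> says
  \<open>p\<^bsup>|U|\<^esup> |\<pi>\<^sub>U| \<le> c n p\<close>, so by concentration the random set contains at most \<open>2 c n p\<close> elements of
  \<open>\<pi>\<^sub>U\<close>, while by Chebyshev's inequality it has at least \<open>n p / 2\<close> elements. Deleting one
  coordinate of each projected configuration destroys all configurations and, for
  \<open>c = (1 - \<delta>) / 4\<close>, leaves a proportion of at least \<open>\<delta>\<close> of the random set.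
\<close>

text \<open>Removing the first entry of every projected configuration that lies in \<open>X\<close>
  costs at most (1 - \<delta>)|X| points, so the rest, \<open>X'\<close>, is large enough to test
  stability. A configuration inside \<open>X'\<close> would project to a member of \<open>A\<close>,
  whose head has been removed. That there is a head at all is where \<open>U\<close> being nonempty
  enters.\<close>

lemma not_config_stable_if_few_projections:
  assumes U: "U \<subseteq> {..<k}" "U \<noteq> {}" and X: "finite X"
    and few: "real (card (proj U (distinct_configs S) \<inter> tuples (card U) X)) \<le> (1 - \<delta>) * real (card X)"
  shows "\<not> config_stable \<delta> k S X"
proof
  define A where "A = proj U (distinct_configs S) \<inter> tuples (card U) X"
  define X' where "X' = X - hd ` A"
  have "A \<subseteq> {xs. set xs \<subseteq> X \<and> length xs = card U}"
    by (auto simp: A_def tuples_def)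
  then have finA: "finite A"
    using finite_lists_length_eq[OF X] finite_subset by blast
  have "card X \<le> card X' + card (hd ` A)"
    unfolding X'_def using diff_card_le_card_Diff[of "hd ` A" X] finA by simp
  also have "\<dots> \<le> card X' + card A"
    using card_image_le[OF finA] by simp
  finally have "real (card X) \<le> real (card X') + real (card A)"
    by linarith
  with few have large: "real (card X') \<ge> \<delta> * real (card X)"
    by (simp add: A_def algebra_simps)
  assume "config_stable \<delta> k S X"
  with large have "tuples k X' \<inter> distinct_configs S \<noteq> {}"
    by (auto simp: config_stable_def X'_def)
  then obtain xs where xs: "xs \<in> tuples k X'" "xs \<in> distinct_configs S"
    by blast
  have len: "length (nths xs U) = card U"
    using xs(1) U(1) by (auto simp: length_nths tuples_def intro!: arg_cong[of _ _ card])
  have sub: "set (nths xs U) \<subseteq> X'"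
    using xs(1) set_nths_subset[of xs U] by (auto simp: tuples_def)
  have "nths xs U \<in> A"
    using xs(2) len sub by (auto simp: A_def proj_def tuples_def X'_def)
  moreover have "hd (nths xs U) \<in> X'"
    using len sub U finite_subset[OF U(1)] by (metis card_0_eq finite_lessThan hd_in_set list.size(3) subsetD)
  ultimately show False
    by (auto simp: X'_def)
qed

text \<open>The variance needed for Chebyshev's inequality, obtained from the moment identities for
  Bernstein polynomials.\<close>

lemma binomial_pmf_second_moment:
  assumes p: "p \<in> {0..1}"
  shows "measure_pmf.expectation (binomial_pmf n p) (\<lambda>k. (real k - real n * p)\<^sup>2) = real n * p * (1 - p)"
proof -
  have "measure_pmf.expectation (binomial_pmf n p) (\<lambda>k. (real k - real n * p)\<^sup>2)
      = (\<Sum>k\<le>n. Bernstein n k p * (real k - real n * p)\<^sup>2)"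
    using p by (simp add: expectation_binomial_pmf' Bernstein_def)
  \<comment> \<open>The square is expanded in the basis k(k - 1), k, 1, whose sums against the
    Bernstein weights have closed forms.\<close>
  also have "\<dots> = (\<Sum>k\<le>n. real k * (real k - 1) * Bernstein n k p
      + (1 - 2 * real n * p) * (real k * Bernstein n k p) + (real n * p)\<^sup>2 * Bernstein n k p)"
    by (intro sum.cong refl) (simp add: power2_eq_square algebra_simps)
  also have "\<dots> = real n * (real n - 1) * p\<^sup>2 + (1 - 2 * real n * p) * (real n * p) + (real n * p)\<^sup>2"
    by (simp add: sum.distrib flip: sum_distrib_left)
  also have "\<dots> = real n * p * (1 - p)"
    by (simp add: power2_eq_square algebra_simps)
  finally show ?thesis .
qed

lemma map_pmf_card_binomial_subset:
  assumes "finite G" "p \<in> {0..1}"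
  shows "map_pmf card (binomial_subset G p) = binomial_pmf (card G) p"
  using assms binomial_pmf_altdef'[of G "card G" p False]
  by (simp add: binomial_subset_def pmf.map_comp o_def)

text \<open>Chebyshev's inequality for the binomially distributed cardinality: the variance is at
  most the mean m, and the deviation is at least m/2.\<close>

lemma prob_binomial_subset_small:
  assumes G: "finite G" and p: "p \<in> {0..1}" and pos: "real (card G) * p > 0"
  shows "measure_pmf.prob (binomial_subset G p) {X. real (card X) \<le> real (card G) * p / 2}
    \<le> 4 / (real (card G) * p)"
proof -
  define m where "m = real (card G) * p"
  have m: "m > 0"
    using pos by (simp add: m_def)
  let ?B = "binomial_pmf (card G) p"
  have "measure_pmf.prob (binomial_subset G p) {X. real (card X) \<le> m / 2}
      = measure_pmf.prob ?B {k. real k \<le> m / 2}"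
    unfolding map_pmf_card_binomial_subset[OF G p, symmetric] measure_map_pmf
    by (simp add: vimage_def)
  \<comment> \<open>The event is enlarged to one about the squared deviation, written with
    \<open>space\<close> to fit Markov's inequality.\<close>
  also have "\<dots> \<le> measure_pmf.prob ?B {k \<in> space (measure_pmf ?B). (real k - m)\<^sup>2 \<ge> (m / 2)\<^sup>2}"
  proof (rule measure_pmf.finite_measure_mono)
    have "(m / 2)\<^sup>2 \<le> (m - real k)\<^sup>2" if "real k \<le> m / 2" for k
      using that m by (intro power_mono) auto
    then show "{k. real k \<le> m / 2} \<subseteq> {k \<in> space (measure_pmf ?B). (real k - m)\<^sup>2 \<ge> (m / 2)\<^sup>2}"
      by (auto simp: power2_commute)
  qed simp
  also have "\<dots> \<le> measure_pmf.expectation ?B (\<lambda>k. (real k - m)\<^sup>2) / (m / 2)\<^sup>2"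
    using m p by (intro integral_Markov_inequality_measure[where A = "{}"]) auto
  also have "\<dots> = m * (1 - p) / (m / 2)\<^sup>2"
    using binomial_pmf_second_moment[OF p, of "card G"] by (simp add: m_def)
  also have "\<dots> \<le> m * 1 / (m / 2)\<^sup>2"
    using m p by (intro divide_right_mono mult_left_mono) auto
  also have "\<dots> = 4 / m"
    using m by (simp add: power2_eq_square)
  finally show ?thesis
    by (simp add: m_def)
qed

lemma finite_binomial_subset:
  assumes "finite G"
  shows "set_pmf (binomial_subset G p) \<subseteq> {X. finite X}"
  using assms by (auto simp: binomial_subset_def)

text \<open>\<open>U\<close> is an index set attaining the maximum in the threshold. Raising the
  bound on \<open>p\<close> to the power |U| - 1 clears the root, and one more factor
  \<open>p\<close> turns it into a bound on the expected number of projected configurations.\<close>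

lemma p_thresholdE:
  assumes "0 < p" "p \<le> c * p_threshold k S G" "0 < c" "c \<le> 1" "distinct_configs S \<noteq> {}"
  obtains U where "U \<subseteq> {..<k}" "card U \<ge> 2"
    "p ^ card U * real (card (proj U (distinct_configs S))) \<le> c * (real (card G) * p)"
proof -
  define F where "F = (\<lambda>U. (real (card G) / real (card (proj U (distinct_configs S)))) powr (1 / (real (card U) - 1)))"
  define M where "M = {F U | U. U \<subseteq> {..<k} \<and> card U \<ge> 2}"
  have fin: "finite M"
  proof -
    have "M \<subseteq> F ` Pow {..<k}"
      by (auto simp: M_def)
    then show ?thesis
      using finite_subset by blast
  qed
  have "p_threshold k S G \<le> Max (insert 0 M)"
    using assms(5) by (simp add: p_threshold_def M_def F_def)
  with assms(2,3) have le: "p \<le> c * Max (insert 0 M)"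
    by (meson mult_left_mono less_imp_le order_trans)
  \<comment> \<open>Since \<open>p\<close> is positive, the inserted 0 is not the maximum, so some
    \<open>U\<close> attains it.\<close>
  with assms(1) have "Max (insert 0 M) \<noteq> 0"
    by force
  with Max_in[of "insert 0 M"] fin have "Max (insert 0 M) \<in> M"
    by auto
  then obtain U where U: "U \<subseteq> {..<k}" "card U \<ge> 2" and F: "Max (insert 0 M) = F U"
    by (auto simp: M_def)
  define P where "P = card (proj U (distinct_configs S))"
  define u where "u = card U - 1"
  have u: "u \<ge> 1" "card U = Suc u"
    using U(2) by (auto simp: u_def)
  have F_def': "F U = (real (card G) / real P) powr (1 / real u)"
    by (simp add: F_def P_def u)
  have "F U \<noteq> 0"
    using F \<open>Max (insert 0 M) \<noteq> 0\<close> by simp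
  \<comment> \<open>As x / 0 = 0 and 0 powr y = 0 in HOL, a nonzero \<open>F U\<close> excludes zero
    in numerator and denominator.\<close>
  then have P: "P > 0" and ratio: "real (card G) / real P > 0"
    by (auto simp: F_def' intro: Nat.gr0I)
  have "p ^ u \<le> (c * F U) ^ u"
    using le F assms(1) by (intro power_mono) auto
  also have "\<dots> = c ^ u * (real (card G) / real P)"
    using ratio u by (simp add: F_def' power_mult_distrib powr_powr flip: powr_realpow' powr_realpow)
  \<comment> \<open>Here \<open>c\<close> \<le> 1 and \<open>u\<close> \<ge> 1 give a factor that
    does not depend on |U|.\<close>
  also have "\<dots> \<le> c * (real (card G) / real P)"
    using power_decreasing[of 1 u c] assms(3,4) u ratio by (intro mult_right_mono) auto
  finally have "p ^ u * real P \<le> c * real (card G)"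
    using P by (simp add: field_simps)
  then have "p * (p ^ u * real P) \<le> p * (c * real (card G))"
    using assms(1) by (intro mult_left_mono) auto
  then have "p ^ card U * real P \<le> c * (real (card G) * p)"
    by (simp add: u mult_ac)
  with that[OF U] show ?thesis
    by (simp add: P_def)
qed

text \<open>The quantitative form for a single system: a union bound over the two bad events, too
  many projected configurations (relative deviation at least 1) and too few points.\<close>

lemma prob_config_stable_le:
  fixes S :: "'a list set" and p :: real
  defines "N \<equiv> \<lambda>U X. real (card (proj U (distinct_configs S) \<inter> tuples (card U) X))"
    and "\<mu> \<equiv> \<lambda>U. p ^ card U * real (card (proj U (distinct_configs S)))"
  assumes G: "finite G" "G \<noteq> {}" and p: "0 < p" "p \<le> 1" and \<delta>: "0 < \<delta>" "\<delta> < 1"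
    and thr: "p \<le> (1 - \<delta>) / 4 * p_threshold k S G" and ne: "distinct_configs S \<noteq> {}"
    and conc: "\<And>U. U \<subseteq> {..<k} \<Longrightarrow> card U \<ge> 2 \<Longrightarrow>
      measure_pmf.prob (binomial_subset G p) {X. \<bar>N U X - \<mu> U\<bar> \<ge> \<mu> U} \<le> e"
  shows "measure_pmf.prob (binomial_subset G p) {X. config_stable \<delta> k S X} \<le> e + 4 / (real (card G) * p)"
proof -
  define m where "m = real (card G) * p"
  have m: "m > 0"
    using G p by (simp add: m_def card_gt_0_iff)
  obtain U where U: "U \<subseteq> {..<k}" "card U \<ge> 2" and \<mu>: "\<mu> U \<le> (1 - \<delta>) / 4 * m"
    using p_thresholdE[OF p(1) thr _ _ ne] \<delta> by (auto simp: \<mu>_def m_def)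
  let ?pr = "measure_pmf.prob (binomial_subset G p)"
  let ?A = "{X. \<bar>N U X - \<mu> U\<bar> \<ge> \<mu> U}" and ?B = "{X. real (card X) \<le> m / 2}"
  have "\<not> config_stable \<delta> k S X" if X: "finite X" "X \<notin> ?A" "X \<notin> ?B" for X
  proof (rule not_config_stable_if_few_projections)
    \<comment> \<open>Off both events, N \<le> 2\<mu> \<le> (1 - \<delta>)m/2 \<le> (1 -
      \<delta>)|X|. The 4 in the constant pays for the 2 in front of \<mu> and for the loss of half
      the mean.\<close>
    have "(1 - \<delta>) * (m / 2) \<le> (1 - \<delta>) * real (card X)"
      using X \<delta> by (intro mult_left_mono) auto
    moreover have "N U X \<le> 2 * \<mu> U"
      using X by auto
    ultimately show "real (card (proj U (distinct_configs S) \<inter> tuples (card U) X)) \<le> (1 - \<delta>) * real (card X)"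
      using \<mu> by (simp add: N_def)
  qed (use U X in auto)
  \<comment> \<open>The inclusion of events holds only for finite \<open>X\<close>, hence almost
    surely.\<close>
  then have "?pr {X. config_stable \<delta> k S X} \<le> ?pr (?A \<union> ?B)"
    using finite_binomial_subset[OF G(1), of p]
    by (intro measure_pmf.finite_measure_mono_AE) (auto simp: AE_measure_pmf_iff)
  also have "\<dots> \<le> ?pr ?A + ?pr ?B"
    by (intro measure_Un_le) auto
  also have "\<dots> \<le> e + 4 / m"
    using conc[OF U] prob_binomial_subset_small[of G p] G p m by (intro add_mono) (auto simp: m_def)
  finally show ?thesis
    by (simp add: m_def)
qed

theorem theorem5p5:
  fixes \<delta> :: real and k :: nat
    and S :: "nat \<Rightarrow> 'a list set" and G :: "nat \<Rightarrow> 'a set"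
  assumes "0 < \<delta>" and "\<delta> < 1" and "k \<ge> 1"
    and "\<And>i. config_system k (S i) (G i)"
  shows "\<exists>c>0. \<forall>p :: nat \<Rightarrow> real.
    (\<forall>i. 0 \<le> p i \<and> p i \<le> 1) \<longrightarrow>
    (\<forall>\<^sub>F i in sequentially. distinct_configs (S i) \<noteq> {}) \<longrightarrow>
    (\<lambda>i. max (1 / real (card (G i)))
             (real (card (distinct_configs (S i))) powr (- 1 / real k))) \<in> o(p) \<longrightarrow>
    (\<forall>i. p i \<le> c * p_threshold k (S i) (G i)) \<longrightarrow>
    concentrated k S G p \<longrightarrow>
    (\<lambda>i. measure_pmf.prob (binomial_subset (G i) (p i)) {X. config_stable \<delta> k (S i) X}) \<longlonglongrightarrow> 0"
proof (intro exI[of _ "(1 - \<delta>) / 4"] conjI allI impI)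
  \<comment> \<open>The constant depends on \<delta> alone.\<close>
  show "(1 - \<delta>) / 4 > 0"
    using assms(2) by simp
next
  fix p :: "nat \<Rightarrow> real"
  assume p: "\<forall>i. 0 \<le> p i \<and> p i \<le> 1"
    and ne: "\<forall>\<^sub>F i in sequentially. distinct_configs (S i) \<noteq> {}"
    and small: "(\<lambda>i. max (1 / real (card (G i)))
             (real (card (distinct_configs (S i))) powr (- 1 / real k))) \<in> o(p)"
    and thr: "\<forall>i. p i \<le> (1 - \<delta>) / 4 * p_threshold k (S i) (G i)"
    and conc: "concentrated k S G p"
  have finG: "finite (G i)" for i
    using assms(4) by (simp add: config_system_def)
  \<comment> \<open>As \<open>k\<close> \<ge> 1, a configuration has an entry, which lies in
    \<open>G i\<close>.\<close>
  have neG: "G i \<noteq> {}" if "distinct_configs (S i) \<noteq> {}" for i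
    using that assms(3) assms(4)[of i] by (fastforce simp: config_system_def distinct_configs_def tuples_def)
  \<comment> \<open>The expected size |G|p tends to infinity, because 1/|G| is bounded by the
    maximum and is therefore o(p).\<close>
  have large: "\<forall>\<^sub>F i in sequentially. distinct_configs (S i) \<noteq> {} \<and> 0 < p i \<and> C \<le> real (card (G i)) * p i"
    if "C > 0" for C :: real
  proof -
    have "\<forall>\<^sub>F i in sequentially. norm (max (1 / real (card (G i)))
        (real (card (distinct_configs (S i))) powr (- 1 / real k))) \<le> inverse C * norm (p i)"
      using landau_o.smallD[OF small, of "inverse C"] that by simp
    with ne show ?thesis
    proof eventually_elim
      case (elim i)
      have n: "real (card (G i)) > 0"
        using neG[OF elim(1)] finG by (simp add: card_gt_0_iff)
      have "1 / real (card (G i)) \<le> inverse C * p i"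
        using elim(2) p by simp
      then have "C \<le> real (card (G i)) * p i"
        using n that by (simp add: field_simps)
      moreover from this have "p i > 0"
        using that n by (smt (verit) mult_nonneg_nonpos)
      ultimately show ?case
        using elim by simp
    qed
  qed
  let ?Q = "\<lambda>i. measure_pmf.prob (binomial_subset (G i) (p i)) {X. config_stable \<delta> k (S i) X}"
  show "?Q \<longlonglongrightarrow> 0"
  proof (rule tendstoI)
    fix r :: real
    assume r: "r > 0"
    define N where "N = (\<lambda>i U X. real (card (proj U (distinct_configs (S i)) \<inter> tuples (card U) X)))"
    define \<mu> where "\<mu> = (\<lambda>i U. p i ^ card U * real (card (proj U (distinct_configs (S i)))))"
    have "\<exists>n\<^sub>0. \<forall>i. card (G i) \<ge> n\<^sub>0 \<longrightarrow> (\<forall>U\<subseteq>{..<k}. card U \<ge> 2 \<longrightarrow>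
        measure_pmf.prob (binomial_subset (G i) (p i)) {X. \<bar>N i U X - \<mu> i U\<bar> \<ge> 1 * \<mu> i U} \<le> r / 3)"
      using conc[unfolded concentrated_def, rule_format, of 1 "r / 3"] r by (simp add: N_def \<mu>_def)
    then obtain n\<^sub>0 where n\<^sub>0: "\<And>i U. card (G i) \<ge> n\<^sub>0 \<Longrightarrow> U \<subseteq> {..<k} \<Longrightarrow> card U \<ge> 2 \<Longrightarrow>
        measure_pmf.prob (binomial_subset (G i) (p i)) {X. \<bar>N i U X - \<mu> i U\<bar> \<ge> \<mu> i U} \<le> r / 3"
      by auto
    \<comment> \<open>The bound \<open>n\<^sub>0\<close> passes from |G|p to |G| because
      \<open>p i\<close> \<le> 1, and 12/r makes the Chebyshev term at most r/3, for a total of 2r/3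
      < r.\<close>
    have "\<forall>\<^sub>F i in sequentially. distinct_configs (S i) \<noteq> {} \<and> 0 < p i \<and>
        max (real n\<^sub>0) (12 / r) \<le> real (card (G i)) * p i"
      using r by (intro large) (simp add: less_max_iff_disj)
    then show "\<forall>\<^sub>F i in sequentially. dist (?Q i) 0 < r"
    proof eventually_elim
      case (elim i)
      have "real (card (G i)) * p i \<le> real (card (G i)) * 1"
        using p by (intro mult_left_mono) auto
      with elim have "card (G i) \<ge> n\<^sub>0"
        by linarith
      then have "?Q i \<le> r / 3 + 4 / (real (card (G i)) * p i)"
        using prob_config_stable_le[OF finG neG, of i "p i" \<delta> k "S i" "r / 3"] elim p thr assms(1,2) n\<^sub>0
        by (simp add: N_def \<mu>_def)
      also have "4 / (real (card (G i)) * p i) \<le> 4 / (12 / r)"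
      proof (rule divide_left_mono)
        have "0 < 12 / r" "12 / r \<le> real (card (G i)) * p i"
          using elim r by auto
        then show "0 < real (card (G i)) * p i * (12 / r)"
          by (metis mult_pos_pos order.strict_trans2)
      qed (use elim in auto)
      finally show ?case
        using r by simp
    qed
  qed
qed

end
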